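(* Let $S$ be a left cancellative monoid with neutral element $e$, and let $R$ be a ring with an $S$-grading $\Gamma: R=\bigoplus_{g\in S}R_g$ of finite support. If $R_e$ is nil and $\mathsf{f}$-commutative, then $R$ is nil. In addition, if $R_e$ is ($\mathsf{f}$-commutative and) nil of bounded index, then $R$ is nil of bounded index.
   Context: Rings are associative, not necessarily with unity. A monoid $S$ is left cancellative if $gh=gt$ implies $h=t$ for all $g,h,t\in S$. An $S$-grading on $R$ is a decomposition $\Gamma: R=\bigoplus_{g\in S}R_g$ into additive subgroups with $R_gR_h\subseteq R_{gh}$ for all $g,h\in S$; its support is $\{g\in S: R_g\neq 0\}$. A ring is nil if each of its elements is nilpotent; it is nil of bounded index if there is a single $n>0$ with $b^n=0$ for all its elements $b$. A left action of a semigroup $\mathfrak{S}$ on a ring $T$ is a map $\mathfrak{S}\times T\to T$, $(\lambda,x)\mapsto\lambda\cdot x$, with $(\lambda\gamma)\cdot x=\lambda\cdot(\gamma\cdot x)$ and $\lambda\cdot(xy)=(\lambda\cdot x)y$ for all $\lambda,\gamma\in\mathfrak{S}$, $x,y\in T$. A ring $T$ is $\mathsf{f}$-commutative if there exist a semigroup $\mathfrak{S}$ acting on the left of $T$ in this sense and a map $\mathsf{f}:T\times T\to\mathfrak{S}$ such that $ab=\mathsf{f}(a,b)\cdot(ba)$ for all $a,b\in T$. *)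

theory Defs
  imports Main
begin

text \<open>
  Rings are types of class \<^class>\<open>ring\<close>, i.e. associative and not necessarily unital.
  The neutral component of a grading is a ring inside \<open>R\<close>; hence the notions for
  rings below are relativised to a subset \<open>T\<close> of the ambient type, meant to be a subring.
\<close>

definition add_subgroup :: "'r::ring set \<Rightarrow> bool" where
  "add_subgroup A \<longleftrightarrow>
     0 \<in> A \<and> (\<forall>x\<in>A. \<forall>y\<in>A. x + y \<in> A) \<and> (\<forall>x\<in>A. - x \<in> A)"

definition grading :: "('s::monoid_mult \<Rightarrow> 'r::ring set) \<Rightarrow> bool" where
  "grading R \<longleftrightarrow>
     (\<forall>g. add_subgroup (R g)) \<and>
     (\<forall>r. \<exists>!x :: 's \<Rightarrow> 'r.
        (\<forall>g. x g \<in> R g) \<and> finite {g. x g \<noteq> 0} \<and> r = (\<Sum>g | x g \<noteq> 0. x g)) \<and>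
     (\<forall>g h. \<forall>x \<in> R g. \<forall>y \<in> R h. x * y \<in> R (g * h))"

definition grading_support :: "('s \<Rightarrow> 'r::ring set) \<Rightarrow> 's set" where
  "grading_support R = {g. R g \<noteq> {0}}"

text \<open>The power \<open>x\<^sup>n\<close> for \<open>n > 0\<close> without using a unit; the value at \<open>n = 0\<close> is junk.\<close>

definition pos_power :: "'r::ring \<Rightarrow> nat \<Rightarrow> 'r" where
  "pos_power x n = (((*) x) ^^ (n - 1)) x"

definition nil :: "'r::ring set \<Rightarrow> bool" where
  "nil T \<longleftrightarrow> (\<forall>b\<in>T. \<exists>n>0. pos_power b n = 0)"

definition nil_bounded :: "'r::ring set \<Rightarrow> bool" where
  "nil_bounded T \<longleftrightarrow> (\<exists>n>0. \<forall>b\<in>T. pos_power b n = 0)"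

definition left_action :: "'r::ring set \<Rightarrow> ('c::semigroup_mult \<Rightarrow> 'r \<Rightarrow> 'r) \<Rightarrow> bool" where
  "left_action T act \<longleftrightarrow>
     (\<forall>l. \<forall>x\<in>T. act l x \<in> T) \<and>
     (\<forall>l m. \<forall>x\<in>T. act (l * m) x = act l (act m x)) \<and>
     (\<forall>l. \<forall>x\<in>T. \<forall>y\<in>T. act l (x * y) = act l x * y)"

text \<open>
  HOL cannot quantify existentially over the type carrying the acting semigroup, so that type
  is a parameter. When \<open>f_commutative\<close> is a hypothesis of a theorem in which \<open>'c\<close> is a free type
  variable, this amounts to the existence of some semigroup.
\<close>

definition f_commutative :: "'c::semigroup_mult itself \<Rightarrow> 'r::ring set \<Rightarrow> bool" where
  "f_commutative (_ :: 'c itself) T \<longleftrightarrow>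
     (\<exists>(act :: 'c \<Rightarrow> 'r \<Rightarrow> 'r) (f :: 'r \<Rightarrow> 'r \<Rightarrow> 'c).
        left_action T act \<and> (\<forall>a\<in>T. \<forall>b\<in>T. a * b = act (f a b) (b * a)))"

end

theory Submission
  imports Defs "HOL-Library.FuncSet" "HOL-Library.Multiset" "HOL-Library.Sublist"
begin

text \<open>
  Write \<open>r = \<Sum>g. x g\<close> with \<open>x g\<close> homogeneous of degree \<open>g\<close>; then \<open>r\<^sup>n\<close> is the sum of the
  products \<open>x g\<^sub>1 \<dots> x g\<^sub>n\<close>, so it suffices that only finitely many words \<open>g\<^sub>1 \<dots> g\<^sub>n\<close> have a
  nonzero product. The prefix degrees of such a word form a walk in the support. Cut the word
  at the returns of its walk to the starting point: by left cancellation the pieces have degree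
  \<open>1\<close>, and inside a piece the walk avoids the starting point, so by induction on the set of
  values that may be visited there are only finitely many pieces. In an \<open>f\<close>-commutative ring
  the vanishing of a product does not depend on the order of the factors, so a piece repeated
  too often can be collected into a vanishing power. Hence the number of pieces is bounded.
\<close>

section \<open>Products of nonempty lists\<close>

text \<open>There is no unit, so the value on the empty list is junk.\<close>

fun pos_prod :: "'r::ring list \<Rightarrow> 'r" where
  "pos_prod [] = 0"
| "pos_prod [a] = a"
| "pos_prod (a # b # bs) = a * pos_prod (b # bs)"

lemma pos_prod_Cons: "bs \<noteq> [] \<Longrightarrow> pos_prod (a # bs) = a * pos_prod bs"
  by (cases bs) auto

lemma pos_prod_append:
  "us \<noteq> [] \<Longrightarrow> vs \<noteq> [] \<Longrightarrow> pos_prod (us @ vs) = pos_prod us * pos_prod vs"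
  by (induction us rule: pos_prod.induct) (auto simp: pos_prod_Cons mult.assoc)

lemma pos_prod_eq_0_sublist:
  assumes "sublist vs ws" "vs \<noteq> []" "pos_prod vs = 0"
  shows "pos_prod ws = 0"
proof -
  obtain us zs where ws: "ws = us @ vs @ zs"
    using assms(1) by (auto simp: sublist_def)
  have "pos_prod (vs @ zs) = 0"
    using assms by (cases "zs = []") (auto simp: pos_prod_append)
  then show ?thesis
    using assms(2) by (cases "us = []") (auto simp: ws pos_prod_append)
qed

lemma pos_prod_concat:
  assumes "[] \<notin> set bs"
  shows "pos_prod (concat bs) = pos_prod (map pos_prod bs)"
  using assms
proof (induction bs rule: induct_list012)
  case (3 a b bs)
  then show ?case
    by (simp add: pos_prod_append eq_commute[of "[]"])
qed simp_all

lemma pos_power_eq_pos_prod: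
  assumes "n > 0"
  shows "pos_power b n = pos_prod (replicate n b)"
proof -
  have "((*) b ^^ m) b = pos_prod (replicate (Suc m) b)" for m
    by (induction m) auto
  from this[of "n - 1"] assms show ?thesis
    by (simp add: pos_power_def)
qed

lemma pos_power_sum:
  assumes "finite A" "n > 0"
  shows "pos_power (\<Sum>g\<in>A. x g) n = (\<Sum>w | set w \<subseteq> A \<and> length w = n. pos_prod (map x w))"
proof -
  let ?words = "\<lambda>n. {w. set w \<subseteq> A \<and> length w = n}"
  have "pos_prod (replicate n (\<Sum>g\<in>A. x g)) = (\<Sum>w\<in>?words n. pos_prod (map x w))"
    using assms(2)
  proof (induction n rule: nat_induct_non_zero)
    case 1
    have "?words 1 = (\<lambda>g. [g]) ` A"
      by (auto simp: length_Suc_conv)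
    then show ?case
      by (simp add: sum.reindex inj_on_def)
  next
    case (Suc n)
    have "pos_prod (replicate (Suc n) (\<Sum>g\<in>A. x g))
        = (\<Sum>w\<in>?words n. \<Sum>g\<in>A. x g * pos_prod (map x w))"
      using Suc by (simp add: pos_prod_Cons sum_distrib_left sum_distrib_right)
    also have "\<dots> = (\<Sum>(w, g)\<in>?words n \<times> A. pos_prod (map x (g # w)))"
      unfolding sum.cartesian_product
      using Suc.hyps by (intro sum.cong) (auto simp: pos_prod_Cons)
    also have "\<dots> = (\<Sum>w\<in>?words (Suc n). pos_prod (map x w))"
      unfolding lists_length_Suc_eq
      by (subst sum.reindex) (auto simp: inj_on_def intro!: sum.cong)
    finally show ?case .
  qed
  then show ?thesis
    using assms(2) by (simp add: pos_power_eq_pos_prod)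
qed

section \<open>Rings in which zero products do not depend on the order of the factors\<close>

text \<open>
  Lambek's symmetric rings; without a unit the condition on triples does not imply the one on
  pairs.
\<close>

definition symmetric_ring :: "'r::ring set \<Rightarrow> bool" where
  "symmetric_ring T \<longleftrightarrow>
     (\<forall>a\<in>T. \<forall>b\<in>T. a * b \<in> T) \<and>
     (\<forall>a\<in>T. \<forall>b\<in>T. a * b = 0 \<longrightarrow> b * a = 0) \<and>
     (\<forall>a\<in>T. \<forall>b\<in>T. \<forall>c\<in>T. a * b * c = 0 \<longrightarrow> b * a * c = 0)"

lemma left_action_0:
  assumes "left_action T act" "0 \<in> T"
  shows "act l 0 = 0"
proof -
  have "act l (0 * 0) = act l 0 * 0"
    using assms unfolding left_action_def by blast
  then show ?thesis by simp
qed

lemma f_commutative_imp_symmetric_ring: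
  assumes "f_commutative TYPE('c::semigroup_mult) T" "0 \<in> T"
    and closed: "\<And>a b. a \<in> T \<Longrightarrow> b \<in> T \<Longrightarrow> a * b \<in> T"
  shows "symmetric_ring T"
proof -
  obtain act :: "'c \<Rightarrow> 'a \<Rightarrow> 'a" and f
    where act: "left_action T act"
      and comm: "\<And>a b. a \<in> T \<Longrightarrow> b \<in> T \<Longrightarrow> a * b = act (f a b) (b * a)"
    using assms(1) unfolding f_commutative_def by blast
  have "b * a = 0" if "a \<in> T" "b \<in> T" "a * b = 0" for a b
    using comm[of b a] left_action_0[OF act \<open>0 \<in> T\<close>] that by simp
  moreover have "b * a * c = 0" if "a \<in> T" "b \<in> T" "c \<in> T" "a * b * c = 0" for a b c
  proof -
    have "b * a * c = act (f b a) (a * b) * c"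
      by (simp flip: comm[OF that(2,1)])
    also have "\<dots> = act (f b a) (a * b * c)"
      using act closed that(1-3) by (simp add: left_action_def)
    also have "\<dots> = 0"
      using left_action_0[OF act \<open>0 \<in> T\<close>] that(4) by simp
    finally show ?thesis .
  qed
  ultimately show ?thesis
    using closed unfolding symmetric_ring_def by blast
qed

lemma symmetric_ring_pos_prod_in:
  assumes "symmetric_ring T" "bs \<in> lists T" "bs \<noteq> []"
  shows "pos_prod bs \<in> T"
proof -
  have "a * b \<in> T" if "a \<in> T" "b \<in> T" for a b
    using assms(1) that unfolding symmetric_ring_def by blast
  then show ?thesis
    using assms(2,3) by (induction bs rule: pos_prod.induct) auto
qed

lemma symmetric_ring_pos_prod_eq_0_rotate:
  assumes "symmetric_ring T" "us @ vs \<in> lists T" "pos_prod (us @ vs) = 0"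
  shows "pos_prod (vs @ us) = 0"
proof (cases "us = [] \<or> vs = []")
  case False
  then have "pos_prod us \<in> T" "pos_prod vs \<in> T" "pos_prod us * pos_prod vs = 0"
    using assms by (auto simp: symmetric_ring_pos_prod_in pos_prod_append)
  then have "pos_prod vs * pos_prod us = 0"
    using assms(1) unfolding symmetric_ring_def by blast
  then show ?thesis
    using False by (simp add: pos_prod_append)
qed (use assms(3) in auto)

lemma symmetric_ring_pos_prod_eq_0_swap_prefix:
  assumes "symmetric_ring T" "us @ vs @ ws \<in> lists T" "pos_prod (us @ vs @ ws) = 0"
  shows "pos_prod (vs @ us @ ws) = 0"
proof (cases "us = [] \<or> vs = [] \<or> ws = []")
  case True
  then show ?thesis
    using assms symmetric_ring_pos_prod_eq_0_rotate[of T us vs] by auto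
next
  case False
  then have "pos_prod us \<in> T" "pos_prod vs \<in> T" "pos_prod ws \<in> T"
      "pos_prod us * pos_prod vs * pos_prod ws = 0"
    using assms by (auto simp: symmetric_ring_pos_prod_in pos_prod_append mult.assoc)
  then have "pos_prod vs * pos_prod us * pos_prod ws = 0"
    using assms(1) unfolding symmetric_ring_def by blast
  then show ?thesis
    using False by (simp add: pos_prod_append mult.assoc)
qed

lemma symmetric_ring_pos_prod_eq_0_swap:
  assumes "symmetric_ring T" "us @ vs @ ws @ zs \<in> lists T" "pos_prod (us @ vs @ ws @ zs) = 0"
  shows "pos_prod (us @ ws @ vs @ zs) = 0"
proof -
  have "pos_prod (vs @ ws @ zs @ us) = 0"
    using symmetric_ring_pos_prod_eq_0_rotate[of T us "vs @ ws @ zs"] assms by simp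
  then have "pos_prod (ws @ vs @ zs @ us) = 0"
    using symmetric_ring_pos_prod_eq_0_swap_prefix[of T vs ws "zs @ us"] assms by simp
  then show ?thesis
    using symmetric_ring_pos_prod_eq_0_rotate[of T "ws @ vs @ zs" us] assms by simp
qed

lemma symmetric_ring_pos_prod_eq_0_permute:
  assumes "symmetric_ring T" "us @ bs \<in> lists T" "mset bs = mset cs" "pos_prod (us @ bs) = 0"
  shows "pos_prod (us @ cs) = 0"
  using assms(2-)
proof (induction bs arbitrary: us cs)
  case (Cons b bs)
  have "b \<in> set cs"
    using Cons.prems(2) by (metis list.set_intros(1) set_mset_mset)
  then obtain cs\<^sub>1 cs\<^sub>2 where cs: "cs = cs\<^sub>1 @ b # cs\<^sub>2"
    by (meson split_list)
  then have mset: "mset bs = mset (cs\<^sub>1 @ cs\<^sub>2)"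
    using Cons.prems(2) by simp
  then have "set bs = set (cs\<^sub>1 @ cs\<^sub>2)"
    by (rule mset_eq_setD)
  then have "us @ [b] @ cs\<^sub>1 @ cs\<^sub>2 \<in> lists T"
    using Cons.prems(1) by auto
  moreover have "pos_prod (us @ [b] @ cs\<^sub>1 @ cs\<^sub>2) = 0"
    using Cons.IH[of "us @ [b]", OF _ mset] Cons.prems(1,3) by simp
  ultimately show ?case
    using symmetric_ring_pos_prod_eq_0_swap[OF assms(1), of us "[b]" cs\<^sub>1 cs\<^sub>2] cs by simp
qed simp

lemma symmetric_ring_pos_prod_eq_0_repeated:
  assumes "symmetric_ring T" "bs \<in> lists T" and "n > 0" "pos_power b n = 0" "n \<le> count_list bs b"
  shows "pos_prod bs = 0"
proof -
  define cs where "cs = filter ((=) b) bs @ filter ((\<noteq>) b) bs"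
  have "filter ((=) b) bs = replicate (count_list bs b) b"
    by (simp add: count_list_eq_length_filter replicate_length_filter)
  also have "\<dots> = replicate n b @ replicate (count_list bs b - n) b"
    using assms(5) by (simp flip: replicate_add)
  finally have "sublist (replicate n b) cs"
    by (simp add: cs_def)
  then have "pos_prod cs = 0"
    by (rule pos_prod_eq_0_sublist) (use assms(3,4) in \<open>auto simp: pos_power_eq_pos_prod\<close>)
  moreover have "cs \<in> lists T"
    using assms(2) by (auto simp: cs_def)
  moreover have "mset cs = mset bs"
    using multiset_partition[of "mset bs" "(=) b"] by (simp add: cs_def)
  ultimately show ?thesis
    using symmetric_ring_pos_prod_eq_0_permute[OF assms(1), of "[]" cs bs] by simp
qed

section \<open>Languages over a left cancellative monoid\<close>

definition left_cancellative :: "'s::monoid_mult itself \<Rightarrow> bool" where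
  "left_cancellative (_ :: 's itself) \<longleftrightarrow> (\<forall>g h t :: 's. g * h = g * t \<longrightarrow> h = t)"

definition sublist_closed :: "'a list set \<Rightarrow> bool" where
  "sublist_closed W \<longleftrightarrow> (\<forall>w\<in>W. \<forall>v. sublist v w \<longrightarrow> v \<in> W)"

lemma sublist_closedD: "sublist_closed W \<Longrightarrow> w \<in> W \<Longrightarrow> sublist v w \<Longrightarrow> v \<in> W"
  unfolding sublist_closed_def by blast

text \<open>The starting point is not part of the walk.\<close>

primrec walk :: "'s::monoid_mult \<Rightarrow> 's list \<Rightarrow> 's list" where
  "walk s [] = []"
| "walk s (g # w) = s * g # walk (s * g) w"

lemma walk_append: "walk s (u @ v) = walk s u @ walk (s * prod_list u) v"
  by (induction u arbitrary: s) (auto simp: mult.assoc)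

lemma set_walk_subset: "set (walk s w) \<subseteq> (\<lambda>v. s * prod_list v) ` {v. prefix v w}"
  by (induction w rule: rev_induct) (auto simp: walk_append mult.assoc intro: rev_image_eqI)

lemma walk_concat_returns:
  "(\<And>b. b \<in> set bs \<Longrightarrow> s * prod_list b = s) \<Longrightarrow>
    walk s (concat bs @ t) = concat (map (walk s) bs) @ walk s t"
  by (induction bs) (auto simp: walk_append)

lemma split_at_returns:
  obtains bs t where "w = concat bs @ t" "s \<notin> set (walk s t)"
    "\<And>b. b \<in> set bs \<Longrightarrow> b \<noteq> [] \<and> s * prod_list b = s \<and> s \<notin> set (butlast (walk s b))"
proof (induction w arbitrary: thesis rule: rev_induct)
  case Nil
  show ?case
    by (rule Nil[of "[]" "[]"]) simp_all
next
  case (snoc g w)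
  obtain bs t where split: "w = concat bs @ t" "s \<notin> set (walk s t)"
    "\<And>b. b \<in> set bs \<Longrightarrow> b \<noteq> [] \<and> s * prod_list b = s \<and> s \<notin> set (butlast (walk s b))"
    using snoc.IH by blast
  show ?case
  proof (cases "s * prod_list (t @ [g]) = s")
    case True
    show ?thesis
      by (rule snoc.prems[of "bs @ [t @ [g]]" "[]"])
        (use split True in \<open>auto simp: walk_append mult.assoc\<close>)
  next
    case False
    show ?thesis
      by (rule snoc.prems[of bs "t @ [g]"])
        (use split False in \<open>auto simp: walk_append mult.assoc\<close>)
  qed
qed

definition walks_in :: "'s::monoid_mult list set \<Rightarrow> 's \<Rightarrow> 's set \<Rightarrow> 's list set" where
  "walks_in W s P = {w \<in> W. set (walk s w) \<subseteq> P}"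

definition excursions :: "'s::monoid_mult list set \<Rightarrow> 's \<Rightarrow> 's set \<Rightarrow> 's list set" where
  "excursions W s P = {w \<in> walks_in W s P. s \<notin> set (butlast (walk s w))}"

definition loops :: "'s::monoid_mult list set" where
  "loops = {w. w \<noteq> [] \<and> prod_list w = 1}"

definition bounded_loop_repetition :: "'s::monoid_mult list set \<Rightarrow> bool" where
  "bounded_loop_repetition W \<longleftrightarrow>
     (\<forall>b\<in>loops. \<exists>n. \<forall>bs\<in>lists loops. concat bs \<in> W \<longrightarrow> count_list bs b \<le> n)"

lemma letter_in_prod_list_image:
  assumes "sublist_closed W" "w \<in> W" "g \<in> set w"
  shows "g \<in> prod_list ` W"
proof -
  have "sublist [g] w"
    using assms(3) by (auto simp: sublist_def dest: split_list)
  then have "[g] \<in> W"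
    by (rule sublist_closedD[OF assms(1,2)])
  then have "prod_list [g] \<in> prod_list ` W"
    by (rule imageI)
  then show ?thesis by simp
qed

lemma finite_excursions:
  assumes closed: "sublist_closed W" and fin: "finite (prod_list ` W)" and "finite P"
    and avoiding: "\<And>t. t \<in> P - {s} \<Longrightarrow> finite (walks_in W t (P - {s}))"
  shows "finite (excursions W s P)"
proof -
  define G where "G = prod_list ` W"
  define U where "U = (\<Union>t\<in>P - {s}. walks_in W t (P - {s}))"
  have "excursions W s P \<subseteq>
    insert [] ((\<lambda>g. [g]) ` G \<union> (\<lambda>(g, u, h). g # u @ [h]) ` (G \<times> U \<times> G))"
  proof
    fix w assume w: "w \<in> excursions W s P"
    have "w \<in> W" and inside: "set (walk s w) \<subseteq> P" "s \<notin> set (butlast (walk s w))"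
      using w by (auto simp: excursions_def walks_in_def)
    then have letters: "set w \<subseteq> G"
      using letter_in_prod_list_image[OF closed] by (auto simp: G_def)
    consider "w = []" | g where "w = [g]" | g u h where "w = g # u @ [h]"
      by (metis list.exhaust rev_exhaust)
    then show "w \<in> insert [] ((\<lambda>g. [g]) ` G \<union> (\<lambda>(g, u, h). g # u @ [h]) ` (G \<times> U \<times> G))"
    proof cases
      case 3
      then have "sublist u w"
        unfolding sublist_def by (intro exI[of _ "[g]"] exI[of _ "[h]"]) simp
      then have "u \<in> W"
        by (rule sublist_closedD[OF closed \<open>w \<in> W\<close>])
      moreover have "s * g \<in> P - {s}" "set (walk (s * g) u) \<subseteq> P - {s}"
        using inside by (auto simp: 3 walk_append butlast_append)
      ultimately have "u \<in> U"
        by (auto simp: U_def walks_in_def)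
      then show ?thesis
        using letters by (force simp: 3)
    qed (use letters in auto)
  qed
  moreover have "finite G" "finite U"
    using fin avoiding \<open>finite P\<close> by (auto simp: G_def U_def)
  ultimately show ?thesis
    by (auto dest: finite_subset)
qed

lemma walks_in_split_excursions:
  assumes "sublist_closed W" and w: "w \<in> walks_in W s P"
  obtains bs t where "w = concat bs @ t" "t \<in> excursions W s P"
    "\<And>b. b \<in> set bs \<Longrightarrow> b \<in> excursions W s P \<and> b \<noteq> [] \<and> s * prod_list b = s"
proof -
  obtain bs t where split: "w = concat bs @ t" and avoids: "s \<notin> set (walk s t)"
    and returns: "\<And>b. b \<in> set bs \<Longrightarrow>
      b \<noteq> [] \<and> s * prod_list b = s \<and> s \<notin> set (butlast (walk s b))"
    using split_at_returns[where w = w and s = s] by blast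
  have subword: "v \<in> W" if "sublist v w" for v
    using sublist_closedD[OF assms(1) _ that] w by (simp add: walks_in_def)
  have "concat (map (walk s) bs) @ walk s t = walk s w"
    using returns by (simp add: split walk_concat_returns)
  then have inside: "set (concat (map (walk s) bs) @ walk s t) \<subseteq> P"
    using w by (simp add: walks_in_def)
  have "t \<in> excursions W s P"
    using inside avoids subword
    by (auto simp: split excursions_def walks_in_def dest: in_set_butlastD)
  moreover have "b \<in> excursions W s P" if "b \<in> set bs" for b
  proof -
    obtain us vs where "bs = us @ b # vs"
      using split_list[OF \<open>b \<in> set bs\<close>] by blast
    then have "w = concat us @ b @ concat vs @ t"
      by (simp add: split)
    then have "sublist b w"
      by simp
    then show ?thesis
      using inside returns subword that by (auto simp: excursions_def walks_in_def)
  qed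
  ultimately show ?thesis
    using that split returns by blast
qed

lemma finite_walks_in_if_finite_excursions:
  assumes left_cancel: "left_cancellative TYPE('s::monoid_mult)"
    and "sublist_closed W" and repetition: "bounded_loop_repetition W"
    and fin: "finite (excursions W s P)"
  shows "finite (walks_in W (s :: 's) P)"
proof -
  define B where "B = excursions W s P"
  obtain n where n: "\<And>b bs. b \<in> loops \<Longrightarrow> bs \<in> lists loops \<Longrightarrow> concat bs \<in> W \<Longrightarrow>
      count_list bs b \<le> n b"
    using repetition unfolding bounded_loop_repetition_def by metis
  define Bs where "Bs = {bs. set bs \<subseteq> B \<and> length bs \<le> sum n B}"
  have "walks_in W s P \<subseteq> (\<lambda>(bs, t). concat bs @ t) ` (Bs \<times> B)"
  proof
    fix w assume w: "w \<in> walks_in W s P"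
    obtain bs t where split: "w = concat bs @ t" and "t \<in> B"
      and returns: "\<And>b. b \<in> set bs \<Longrightarrow> b \<in> B \<and> b \<noteq> [] \<and> s * prod_list b = s"
      using walks_in_split_excursions[OF assms(2) w] unfolding B_def by metis
    have "prod_list b = 1" if "b \<in> set bs" for b
      using left_cancel returns[OF that] unfolding left_cancellative_def by (metis mult_1_right)
    then have "bs \<in> lists loops"
      using returns by (auto simp: loops_def)
    moreover have "concat bs \<in> W"
      using sublist_closedD[OF assms(2), of w "concat bs"] w by (simp add: split walks_in_def)
    ultimately have "count_list bs b \<le> n b" for b
      using n[of b bs] by (cases "b \<in> set bs") auto
    then have "sum (count_list bs) B \<le> sum n B"
      by (rule sum_mono)
    moreover have "set bs \<subseteq> B"
      using returns by blast
    ultimately have "bs \<in> Bs"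
      using fin by (simp add: B_def Bs_def sum_count_set)
    then show "w \<in> (\<lambda>(bs, t). concat bs @ t) ` (Bs \<times> B)"
      using split \<open>t \<in> B\<close> by force
  qed
  moreover have "finite Bs" "finite B"
    using fin by (auto simp: B_def Bs_def intro!: finite_lists_length_le)
  ultimately show ?thesis
    by (auto dest: finite_subset)
qed

lemma finite_walks_in:
  assumes "left_cancellative TYPE('s::monoid_mult)"
    and "sublist_closed W" "bounded_loop_repetition W" "finite (prod_list ` W)"
    and "finite P" "s \<in> P"
  shows "finite (walks_in W (s :: 's) P)"
  using assms(5,6)
proof (induction P arbitrary: s rule: finite_psubset_induct)
  case (psubset P)
  have "finite (walks_in W t (P - {s}))" if "t \<in> P - {s}" for t
    using psubset.IH[of "P - {s}" t] psubset.prems that by blast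
  then have "finite (excursions W s P)"
    using assms(2,4) psubset.hyps by (intro finite_excursions)
  then show ?case
    by (rule finite_walks_in_if_finite_excursions[OF assms(1-3)])
qed

lemma finite_language_if_bounded_loop_repetition:
  assumes "left_cancellative TYPE('s::monoid_mult)"
    and closed: "sublist_closed W"
    and "bounded_loop_repetition W" "finite (prod_list ` W)"
  shows "finite (W :: 's list set)"
proof -
  define P where "P = insert 1 (prod_list ` W)"
  have "set (walk 1 w) \<subseteq> P" if "w \<in> W" for w
    using set_walk_subset[of 1 w] closed that by (auto simp: P_def sublist_closed_def)
  then have "W \<subseteq> walks_in W 1 P"
    by (auto simp: walks_in_def)
  moreover have "finite (walks_in W 1 P)"
    using assms by (intro finite_walks_in) (auto simp: P_def)
  ultimately show ?thesis
    by (rule finite_subset)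
qed

section \<open>Words with nonvanishing products of homogeneous elements\<close>

definition nonvanishing_words :: "('s \<Rightarrow> 'r::ring) set \<Rightarrow> 's list set" where
  "nonvanishing_words X = insert [] {w. \<exists>x\<in>X. pos_prod (map x w) \<noteq> 0}"

lemma sublist_closed_nonvanishing_words: "sublist_closed (nonvanishing_words X)"
proof -
  have "pos_prod (map x v) \<noteq> 0" if "sublist v w" "v \<noteq> []" "pos_prod (map x w) \<noteq> 0"
    for v w and x :: "'a \<Rightarrow> 'b"
    using pos_prod_eq_0_sublist[OF map_mono_sublist[OF that(1)]] that(2,3) by auto
  then show ?thesis
    by (auto simp: sublist_closed_def nonvanishing_words_def)
qed

lemma grading_add_subgroup: "grading R \<Longrightarrow> add_subgroup (R g)"
  by (simp add: grading_def)

lemma grading_mult: "grading R \<Longrightarrow> a \<in> R g \<Longrightarrow> b \<in> R h \<Longrightarrow> a * b \<in> R (g * h)"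
  by (simp add: grading_def)

lemma grading_pos_prod:
  assumes "grading R" "x \<in> Pi UNIV R" "w \<noteq> []"
  shows "pos_prod (map x w) \<in> R (prod_list w)"
  using assms(3)
proof (induction w rule: list_nonempty_induct)
  case (cons g w)
  then show ?case
    using assms(1,2) by (auto simp: pos_prod_Cons intro: grading_mult)
qed (use assms(2) in auto)

lemma grading_pos_prod_loop:
  assumes "grading R" "x \<in> Pi UNIV R" "b \<in> loops"
  shows "pos_prod (map x b) \<in> R 1"
  using grading_pos_prod[OF assms(1,2), of b] assms(3) by (simp add: loops_def)

lemma grading_sum_surj:
  assumes "grading R" "finite (grading_support R)"
  shows "(\<lambda>x. \<Sum>g\<in>grading_support R. x g) ` Pi UNIV R = UNIV"
proof -
  have "\<exists>x\<in>Pi UNIV R. r = (\<Sum>g\<in>grading_support R. x g)" for r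
  proof -
    obtain x where x: "\<forall>g. x g \<in> R g" "r = (\<Sum>g | x g \<noteq> 0. x g)"
      using assms(1) unfolding grading_def by metis
    have "(\<Sum>g | x g \<noteq> 0. x g) = (\<Sum>g\<in>grading_support R. x g)"
      using x(1) assms(2) by (intro sum.mono_neutral_left) (auto simp: grading_support_def)
    then show ?thesis
      using x by auto
  qed
  then show ?thesis by blast
qed

lemma prod_list_nonvanishing_words:
  assumes "grading R" "X \<subseteq> Pi UNIV R"
  shows "prod_list ` nonvanishing_words X \<subseteq> insert 1 (grading_support R)"
proof -
  have "prod_list w \<in> grading_support R" if "x \<in> X" "pos_prod (map x w) \<noteq> 0" for w x
  proof -
    have "w \<noteq> []"
      using that(2) by auto
    then show ?thesis
      using grading_pos_prod[OF assms(1), of x w] assms(2) that by (auto simp: grading_support_def)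
  qed
  then show ?thesis
    by (auto simp: nonvanishing_words_def)
qed

lemma pos_prod_concat_loops_eq_0:
  assumes "grading R" "symmetric_ring (R 1)" and x: "x \<in> Pi UNIV R"
    and bs: "bs \<in> lists loops"
    and "n > 0" "pos_power (pos_prod (map x b)) n = 0" "n \<le> count_list bs b"
  shows "pos_prod (map x (concat bs)) = 0"
proof -
  define p where "p = (\<lambda>v. pos_prod (map x v))"
  have "map p bs \<in> lists (R 1)"
    using grading_pos_prod_loop[OF assms(1) x] bs by (simp add: p_def in_lists_conv_set)
  moreover have "n \<le> count_list (map p bs) (p b)"
    using count_list_map_ge[of bs b p] assms(7) by simp
  ultimately have "pos_prod (map p bs) = 0"
    using symmetric_ring_pos_prod_eq_0_repeated[OF assms(2)] assms(5,6) by (simp add: p_def)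
  moreover have "[] \<notin> set (map (map x) bs)"
    using bs by (auto simp: loops_def)
  ultimately show ?thesis
    by (simp add: map_concat pos_prod_concat p_def comp_def)
qed

lemma bounded_loop_repetition_nonvanishing_words:
  fixes R :: "'s::monoid_mult \<Rightarrow> 'r::ring set"
  assumes "grading R" "symmetric_ring (R 1)" "X \<subseteq> Pi UNIV R"
    and nil: "\<And>b. b \<in> loops \<Longrightarrow> nil_bounded ((\<lambda>x. pos_prod (map x b)) ` X)"
  shows "bounded_loop_repetition (nonvanishing_words X)"
  unfolding bounded_loop_repetition_def
proof
  fix b :: "'s list" assume "b \<in> loops"
  then obtain n where n: "n > 0" "\<And>x. x \<in> X \<Longrightarrow> pos_power (pos_prod (map x b)) n = 0"
    using nil[of b] by (auto simp: nil_bounded_def)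
  have "concat bs \<notin> nonvanishing_words X" if "bs \<in> lists loops" "count_list bs b > n" for bs
  proof -
    have "pos_prod (map x (concat bs)) = 0" if "x \<in> X" for x
      using assms(1-3) \<open>bs \<in> lists loops\<close> n \<open>count_list bs b > n\<close> that
      by (intro pos_prod_concat_loops_eq_0[of R x bs n b]) auto
    moreover have "concat bs \<noteq> []"
      using that by (cases bs) (auto simp: loops_def)
    ultimately show ?thesis
      by (simp add: nonvanishing_words_def)
  qed
  then show "\<exists>n. \<forall>bs\<in>lists loops. concat bs \<in> nonvanishing_words X \<longrightarrow> count_list bs b \<le> n"
    using not_le by blast
qed

lemma nil_bounded_mono: "nil_bounded T \<Longrightarrow> U \<subseteq> T \<Longrightarrow> nil_bounded U"
  unfolding nil_bounded_def by blast

lemma nil_iff_nil_bounded_singletons: "nil T \<longleftrightarrow> (\<forall>b\<in>T. nil_bounded {b})"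
  by (simp add: nil_def nil_bounded_def)

lemma nil_bounded_sums_if_finite_nonvanishing_words:
  assumes "finite A" "finite (nonvanishing_words X)"
  shows "nil_bounded ((\<lambda>x. \<Sum>g\<in>A. x g) ` X)"
proof -
  define n where "n = Suc (Max (length ` nonvanishing_words X))"
  have "pos_prod (map x w) = 0" if "x \<in> X" "length w = n" for x w
  proof (rule ccontr)
    assume "pos_prod (map x w) \<noteq> 0"
    then have "w \<in> nonvanishing_words X"
      using that by (auto simp: nonvanishing_words_def)
    then have "length w \<le> Max (length ` nonvanishing_words X)"
      using assms(2) by simp
    then show False
      using that by (simp add: n_def)
  qed
  then have "pos_power (\<Sum>g\<in>A. x g) n = 0" if "x \<in> X" for x
    using assms(1) that by (simp add: pos_power_sum n_def)
  then show ?thesis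
    unfolding nil_bounded_def by (intro exI[of _ n]) (auto simp: n_def)
qed

text \<open>
  A single family \<open>X = {x}\<close> gives the nilpotency of one element; the set of all families gives
  a bounded index.
\<close>

lemma nil_bounded_homogeneous_sums:
  fixes R :: "'s::monoid_mult \<Rightarrow> 'r::ring set"
  assumes left_cancel: "left_cancellative TYPE('s)"
    and grading: "grading R" and finite_support: "finite (grading_support R)"
    and "symmetric_ring (R 1)" and X: "X \<subseteq> Pi UNIV R"
    and "\<And>b. b \<in> loops \<Longrightarrow> nil_bounded ((\<lambda>x. pos_prod (map x b)) ` X)"
  shows "nil_bounded ((\<lambda>x. \<Sum>g\<in>grading_support R. x g) ` X)"
proof (rule nil_bounded_sums_if_finite_nonvanishing_words[OF finite_support])
  have "finite (prod_list ` nonvanishing_words X)"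
    using prod_list_nonvanishing_words[OF grading X] finite_support by (simp add: finite_subset)
  moreover have "bounded_loop_repetition (nonvanishing_words X)"
    using assms by (intro bounded_loop_repetition_nonvanishing_words)
  ultimately show "finite (nonvanishing_words X)"
    by (intro finite_language_if_bounded_loop_repetition left_cancel
        sublist_closed_nonvanishing_words)
qed

theorem theorem3p8:
  fixes R :: "'s::monoid_mult \<Rightarrow> 'r::ring set"
  assumes left_cancel: "\<And>g h t :: 's. g * h = g * t \<Longrightarrow> h = t"
    and grading: "grading R"
    and finite_support: "finite (grading_support R)"
    and f_comm: "f_commutative TYPE('c::semigroup_mult) (R 1)"
  shows "(nil (R 1) \<longrightarrow> nil (UNIV :: 'r set)) \<and>
         (nil_bounded (R 1) \<longrightarrow> nil_bounded (UNIV :: 'r set))"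
proof -
  have "symmetric_ring (R 1)"
    using f_comm grading_add_subgroup[OF grading] grading_mult[OF grading, of _ 1 _ 1]
    by (intro f_commutative_imp_symmetric_ring) (auto simp: add_subgroup_def)
  moreover have "left_cancellative TYPE('s)"
    using left_cancel by (auto simp: left_cancellative_def)
  ultimately have sums: "nil_bounded ((\<lambda>x. \<Sum>g\<in>grading_support R. x g) ` X)"
    if "X \<subseteq> Pi UNIV R" "\<And>b. b \<in> loops \<Longrightarrow> nil_bounded ((\<lambda>x. pos_prod (map x b)) ` X)" for X
    using nil_bounded_homogeneous_sums grading finite_support that by blast
  note surj = grading_sum_surj[OF grading finite_support]
  note loop = grading_pos_prod_loop[OF grading]
  have "nil_bounded {r}" if "nil (R 1)" for r :: 'r
  proof -
    obtain x where "x \<in> Pi UNIV R" "r = (\<Sum>g\<in>grading_support R. x g)"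
      using surj by blast
    then show ?thesis
      using sums[of "{x}"] loop that by (simp add: nil_iff_nil_bounded_singletons)
  qed
  moreover have "nil_bounded (UNIV :: 'r set)" if "nil_bounded (R 1)"
    using sums[of "Pi UNIV R"] nil_bounded_mono[OF that] loop by (simp add: surj image_subset_iff)
  ultimately show ?thesis
    by (simp add: nil_iff_nil_bounded_singletons)
qed

end
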